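(* For all $\alpha>0$, $k^t\in\mathbb{N}$, $k^d\in\mathbb{N}$, the competitive ratio of the policy Optimistic satisfies $$\sigma(\mathrm{Optimistic})\ \le\ \min\left\{2,\ 1+\left\lceil\frac{k^d}{k^t}\right\rceil\alpha\right\}.$$
   Context: Relief distribution problem (RDP). $\mathbb{N}=\{1,2,\dots\}$. An instance is $I=(k^t,k^d,\alpha,G,D)$: $k^t,k^d\in\mathbb{N}$ are the numbers of trucks and drones; $\alpha>0$ is the drone speed; $G=(V,E,c)$ is a finite connected undirected graph (not necessarily complete) with $V=\{v_0\}\cup C$, where $v_0$ is the depot and $C\neq\emptyset$ is the set of non-depot nodes; edge lengths $c(i,j)>0$ satisfy the triangle inequality; $D\subseteq C$ is the set of damaged nodes, initially unknown; the status of a node is revealed when some vehicle first arrives at it. For non-adjacent $i,j$, $c(i,j)$ is the shortest-path distance. A truck needs time $c(i,j)$ to traverse an edge, a drone needs $\frac1\alpha c(i,j)$. A tour is a closed walk in $G$ starting and ending at $v_0$ (possibly of length $0$); it visits all nodes lying on it. The makespan of a family of tours is the maximum duration of a tour. Full-information optimum: $\mathrm{OPT}(I^* )$ is the minimum makespan over all families of $k^t$ truck tours and $k^d$ drone tours such that every node of $C$ is visited by some vehicle and every node of $D$ is visited by a truck ($I^*$ is the instance $I$ with $D$ known in advance). For integers $m,n\ge 0$ with $m+n\ge1$ and $W\subseteq C$, $\mathrm{TSP}_{m,n}(W)$ denotes the minimum makespan over all families of $m$ truck tours and $n$ drone tours that together visit all nodes of $W$, and $S^*_{m,n}(W)$ denotes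 an optimal such family. Policy Optimistic (deterministic; optimal families are selected by a fixed rule based only on the information available at that time, so the first-stage tours do not depend on $D$). First stage: the vehicles execute the tours of $S^*_{k^t,k^d}(C)$ and return to the depot. Let $D^d\subseteq D$ be the set of damaged nodes not visited by truck tours in this stage. Second stage (after all vehicles returned): the trucks execute $S^*_{k^t,0}(D^d)$. Its makespan is $\mathrm{Optimistic}(I)=\mathrm{TSP}_{k^t,k^d}(C)+\mathrm{TSP}_{k^t,0}(D^d)$. Competitive ratio: $\sigma(\mathrm{Optimistic})=\sup_I \frac{\mathrm{Optimistic}(I)}{\mathrm{OPT}(I^* )}$, the supremum being over all instances $I$ with the given $k^t,k^d,\alpha$. *)

theory Defs
  imports "HOL-Library.Extended_Real" "Graph_Theory.Graph_Theory"
begin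

section \<open>Networks and tours\<close>

text \<open>
  An undirected edge is represented by the two opposite arcs of a symmetric digraph without
  loops and parallel arcs; only the values of the length function \<open>len\<close> on arcs matter.
\<close>

record 'v network =
  graph_of :: "'v pair_pre_digraph"
  depot :: 'v
  len :: "'v \<times> 'v \<Rightarrow> real"

definition customers :: "'v network \<Rightarrow> 'v set" where
  "customers N = pverts (graph_of N) - {depot N}"

text \<open>
  The edge length for adjacent nodes, extended to the remaining pairs by the shortest-path distance.
\<close>

definition dist_of :: "'v network \<Rightarrow> 'v \<Rightarrow> 'v \<Rightarrow> ereal" where
  "dist_of N i j =
     (if (i, j) \<in> parcs (graph_of N) then ereal (len N (i, j))
      else wf_digraph.\<mu> (with_proj (graph_of N)) (len N) i j)"

definition relief_network :: "'v network \<Rightarrow> bool" where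
  "relief_network N \<longleftrightarrow>
     pair_graph (graph_of N) \<and>
     Digraph_Component.connected (with_proj (graph_of N)) \<and>
     depot N \<in> pverts (graph_of N) \<and>
     customers N \<noteq> {} \<and>
     (\<forall>(i, j) \<in> parcs (graph_of N). len N (i, j) > 0 \<and> len N (j, i) = len N (i, j)) \<and>
     (\<forall>i \<in> pverts (graph_of N). \<forall>j \<in> pverts (graph_of N). \<forall>k \<in> pverts (graph_of N).
        dist_of N i k \<le> dist_of N i j + dist_of N j k)"

type_synonym 'v tour = "('v \<times> 'v) list"

definition is_tour :: "'v network \<Rightarrow> 'v tour \<Rightarrow> bool" where
  "is_tour N p \<longleftrightarrow> pre_digraph.awalk (with_proj (graph_of N)) (depot N) p (depot N)"

definition tour_length :: "'v network \<Rightarrow> 'v tour \<Rightarrow> real" where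
  "tour_length N p = wf_digraph.awalk_cost (len N) p"

definition visited :: "'v network \<Rightarrow> 'v tour list \<Rightarrow> 'v set" where
  "visited N ps = (\<Union>p \<in> set ps. set (pawalk_verts (depot N) p))"

section \<open>Families of tours and their makespan\<close>

text \<open>A plan consists of the truck tours and the drone tours, in this order.\<close>

type_synonym 'v plan = "'v tour list \<times> 'v tour list"

definition plans :: "'v network \<Rightarrow> nat \<Rightarrow> nat \<Rightarrow> 'v plan set" where
  "plans N m n = {(T, U). length T = m \<and> length U = n \<and> (\<forall>p \<in> set T \<union> set U. is_tour N p)}"

definition makespan :: "'v network \<Rightarrow> real \<Rightarrow> 'v plan \<Rightarrow> real" where
  "makespan N \<alpha> = (\<lambda>(T, U).
     Max (tour_length N ` set T \<union> (\<lambda>p. 1 / \<alpha> * tour_length N p) ` set U))"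

definition min_makespan :: "'v network \<Rightarrow> real \<Rightarrow> 'v plan set \<Rightarrow> real" where
  "min_makespan N \<alpha> P = (LEAST t. t \<in> makespan N \<alpha> ` P)"

definition covering_plans :: "'v network \<Rightarrow> nat \<Rightarrow> nat \<Rightarrow> 'v set \<Rightarrow> 'v plan set" where
  "covering_plans N m n W = {(T, U) \<in> plans N m n. W \<subseteq> visited N T \<union> visited N U}"

definition TSP :: "'v network \<Rightarrow> real \<Rightarrow> nat \<Rightarrow> nat \<Rightarrow> 'v set \<Rightarrow> real" where
  "TSP N \<alpha> m n W = min_makespan N \<alpha> (covering_plans N m n W)"

definition optimal_plan ::
    "'v network \<Rightarrow> real \<Rightarrow> nat \<Rightarrow> nat \<Rightarrow> 'v set \<Rightarrow> 'v plan \<Rightarrow> bool" where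
  "optimal_plan N \<alpha> m n W F \<longleftrightarrow>
     F \<in> covering_plans N m n W \<and>
     (\<forall>F' \<in> covering_plans N m n W. makespan N \<alpha> F \<le> makespan N \<alpha> F')"

section \<open>Minimum makespans are attained\<close>

text \<open>
  Edge lengths are bounded below by a positive constant, hence only finitely many tours stay below
  a given duration. So the minima above exist, and selection rules as defined below exist as well.
\<close>

lemma tour_length_ge:
  assumes "relief_network N"
  obtains \<delta> where "\<delta> > 0" "\<And>p. is_tour N p \<Longrightarrow> tour_length N p \<ge> \<delta> * real (length p)"
proof -
  let ?A = "parcs (graph_of N)"
  have fin: "finite ?A" and pos: "\<And>e. e \<in> ?A \<Longrightarrow> len N e > 0"
    using assms unfolding relief_network_def
    by (auto simp: pair_graph_def pair_digraph_def pair_fin_digraph_def pair_fin_digraph_axioms_def)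
  define \<delta> where "\<delta> = Min (insert 1 (len N ` ?A))"
  have d: "\<delta> > 0" unfolding \<delta>_def using fin pos by auto
  have le: "\<delta> \<le> len N e" if "e \<in> ?A" for e
    unfolding \<delta>_def using fin that by (intro Min_le) auto
  have "set p \<subseteq> ?A \<Longrightarrow> sum_list (map (len N) p) \<ge> \<delta> * real (length p)" for p
    by (induction p) (auto simp: algebra_simps intro: add_mono dest!: le)
  moreover have "wf_digraph (with_proj (graph_of N))"
    using assms by (simp add: relief_network_def wf_digraph_wp_iff pair_graph_def pair_digraph_def
          pair_fin_digraph_def)
  ultimately have "\<And>p. is_tour N p \<Longrightarrow> tour_length N p \<ge> \<delta> * real (length p)"
    by (simp add: is_tour_def tour_length_def pre_digraph.awalk_def
          wf_digraph.awalk_cost_def[where G = "with_proj (graph_of N)"])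
  with d show ?thesis by (rule that)
qed

lemma finite_short_tours:
  assumes "relief_network N"
  shows "finite {p. is_tour N p \<and> tour_length N p \<le> B}"
proof -
  obtain \<delta> where d: "\<delta> > 0" "\<And>p. is_tour N p \<Longrightarrow> tour_length N p \<ge> \<delta> * real (length p)"
    using tour_length_ge[OF assms] by blast
  have "finite {p. set p \<subseteq> parcs (graph_of N) \<and> length p \<le> nat \<lceil>B / \<delta>\<rceil>}"
    using assms unfolding relief_network_def
    by (intro finite_lists_length_le)
      (auto simp: pair_graph_def pair_digraph_def pair_fin_digraph_def pair_fin_digraph_axioms_def)
  moreover have "{p. is_tour N p \<and> tour_length N p \<le> B} \<subseteq> \<dots>"
  proof clarify
    fix p assume p: "is_tour N p" "tour_length N p \<le> B"
    have "real (length p) * \<delta> \<le> B" using d(2)[OF p(1)] p(2) by (simp add: mult.commute)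
    then have "real (length p) \<le> B / \<delta>" using d(1) by (simp add: field_simps)
    then have "length p \<le> nat \<lceil>B / \<delta>\<rceil>" by linarith
    moreover have "set p \<subseteq> parcs (graph_of N)"
      using p(1) by (auto simp: is_tour_def pre_digraph.awalk_def)
    ultimately show "set p \<subseteq> parcs (graph_of N) \<and> length p \<le> nat \<lceil>B / \<delta>\<rceil>" by blast
  qed
  ultimately show ?thesis by (rule finite_subset[rotated])
qed

lemma finite_short_plans:
  assumes "relief_network N" and "\<alpha> > 0"
  shows "finite {F \<in> plans N m n. makespan N \<alpha> F \<le> B}"
proof -
  let ?R = "{p. is_tour N p \<and> tour_length N p \<le> max B (\<alpha> * B)}"
  have "{F \<in> plans N m n. makespan N \<alpha> F \<le> B} \<subseteq>
      {T. set T \<subseteq> ?R \<and> length T = m} \<times> {U. set U \<subseteq> ?R \<and> length U = n}"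
  proof (rule subsetI, elim CollectE conjE, unfold split_paired_all)
    fix T U assume F: "(T, U) \<in> plans N m n" and le: "makespan N \<alpha> (T, U) \<le> B"
    have T: "tour_length N p \<le> B" if "p \<in> set T" for p
      using that by (intro order_trans[OF Max_ge le[unfolded makespan_def case_prod_conv]]) auto
    have "1 / \<alpha> * tour_length N p \<le> B" if "p \<in> set U" for p
      using that by (intro order_trans[OF Max_ge le[unfolded makespan_def case_prod_conv]]) auto
    then have U: "tour_length N p \<le> \<alpha> * B" if "p \<in> set U" for p
      using that \<open>\<alpha> > 0\<close> by (fastforce simp: field_simps)
    show "(T, U) \<in> {T. set T \<subseteq> ?R \<and> length T = m} \<times> {U. set U \<subseteq> ?R \<and> length U = n}"
      using F T U unfolding plans_def by (auto simp: max.coboundedI1 max.coboundedI2)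
  qed
  then show ?thesis
    by (rule finite_subset) (intro finite_cartesian_product finite_lists_length_eq finite_short_tours assms)
qed

lemma optimum_attained:
  assumes "relief_network N" and "\<alpha> > 0" and "P \<subseteq> plans N m n" and "P \<noteq> {}"
  shows "\<exists>F \<in> P. \<forall>F' \<in> P. makespan N \<alpha> F \<le> makespan N \<alpha> F'"
proof -
  obtain F0 where F0: "F0 \<in> P" using assms(4) by blast
  let ?Q = "{F \<in> P. makespan N \<alpha> F \<le> makespan N \<alpha> F0}"
  have fin: "finite ?Q"
    by (rule finite_subset[OF _ finite_short_plans[OF assms(1,2)]]) (use assms(3) in auto)
  have ne: "?Q \<noteq> {}" using F0 by blast
  obtain F where F: "F \<in> ?Q" "\<forall>F' \<in> ?Q. makespan N \<alpha> F \<le> makespan N \<alpha> F'"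
    using ex_is_arg_min_if_finite[OF fin ne, of "makespan N \<alpha>"]
    unfolding is_arg_min_linorder by blast
  have "makespan N \<alpha> F \<le> makespan N \<alpha> F'" if "F' \<in> P" for F'
  proof (cases "makespan N \<alpha> F' \<le> makespan N \<alpha> F0")
    case True
    with F(2) that show ?thesis by blast
  next
    case False
    moreover have "makespan N \<alpha> F \<le> makespan N \<alpha> F0" using F(1) by blast
    ultimately show ?thesis by linarith
  qed
  with F show ?thesis by blast
qed

lemma min_makespan_eq:
  assumes "F \<in> P" and "\<forall>F' \<in> P. makespan N \<alpha> F \<le> makespan N \<alpha> F'"
  shows "min_makespan N \<alpha> P = makespan N \<alpha> F"
  unfolding min_makespan_def by (rule Least_equality) (use assms in auto)

lemma covering_tour:
  assumes "relief_network N" and "W \<subseteq> customers N"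
  shows "\<exists>p. is_tour N p \<and> W \<subseteq> set (pawalk_verts (depot N) p)"
proof -
  let ?G = "graph_of N"
  interpret pair_graph ?G using assms(1) by (simp add: relief_network_def)
  have dep: "depot N \<in> pverts ?G" using assms(1) by (simp add: relief_network_def)
  have sc: "strongly_connected (with_proj ?G)"
    using assms(1) unfolding relief_network_def
    by (intro symmetric_connected_imp_strongly_connected) (auto simp: pair_sym_arcs)
  have "finite W" using assms(2) pair_finite_verts
    by (auto simp: customers_def intro: finite_subset)
  then show ?thesis using assms(2)
  proof (induction W)
    case empty
    have "is_tour N []" using dep by (simp add: is_tour_def awalk_Nil_iff)
    then show ?case by auto
  next
    case (insert w W)
    then obtain p where p: "awalk (depot N) p (depot N)" "W \<subseteq> set (pawalk_verts (depot N) p)"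
      by (auto simp: is_tour_def)
    have w: "w \<in> pverts ?G" using insert.prems by (auto simp: customers_def)
    obtain q r where q: "awalk (depot N) q w" and r: "awalk w r (depot N)"
      using sc dep w by (fastforce simp: strongly_connected_def reachable_awalk)
    have t: "awalk (depot N) (q @ r @ p) (depot N)" using p q r by (meson awalk_appendI)
    have qr: "awalk (depot N) (q @ r) (depot N)" using q r by (meson awalk_appendI)
    have "set (pawalk_verts (depot N) ((q @ r) @ p)) =
        set (pawalk_verts (depot N) (q @ r)) \<union> set (pawalk_verts (depot N) p)"
      using t set_awalk_verts_append[of "depot N" "q @ r" "depot N" p "depot N"] qr p by auto
    moreover have "w \<in> set (pawalk_verts (depot N) (q @ r))"
      using set_awalk_verts_append[OF q r] hd_in_awalk_verts(1)[OF r] by auto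
    ultimately show ?case using t p(2)
      by (intro exI[of _ "q @ r @ p"]) (auto simp: is_tour_def)
  qed
qed

lemma optimal_plan_exists:
  assumes "relief_network N" and "\<alpha> > 0" and "m + n \<ge> 1" and "W \<subseteq> customers N"
  shows "\<exists>F. optimal_plan N \<alpha> m n W F"
proof -
  obtain p where p: "is_tour N p" "W \<subseteq> set (pawalk_verts (depot N) p)"
    using covering_tour[OF assms(1,4)] by blast
  have "(replicate m p, replicate n p) \<in> covering_plans N m n W"
    using p assms(3) by (cases m; cases n) (auto simp: covering_plans_def plans_def visited_def)
  then have "covering_plans N m n W \<noteq> {}" by auto
  moreover have "covering_plans N m n W \<subseteq> plans N m n" by (auto simp: covering_plans_def)
  ultimately show ?thesis
    using optimum_attained[OF assms(1,2)] unfolding optimal_plan_def by blast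
qed

lemma TSP_eq_makespan: "optimal_plan N \<alpha> m n W F \<Longrightarrow> TSP N \<alpha> m n W = makespan N \<alpha> F"
  unfolding TSP_def optimal_plan_def by (blast intro: min_makespan_eq)

section \<open>Instances, full-information optimum and the policy\<close>

record 'v rdp_instance =
  trucks :: nat
  drones :: nat
  speed :: real
  net :: "'v network"
  damaged :: "'v set"

definition valid_instance :: "'v rdp_instance \<Rightarrow> bool" where
  "valid_instance I \<longleftrightarrow>
     trucks I \<ge> 1 \<and> drones I \<ge> 1 \<and> speed I > 0 \<and>
     relief_network (net I) \<and> damaged I \<subseteq> customers (net I)"

definition OPT :: "'v rdp_instance \<Rightarrow> real" where
  "OPT I = min_makespan (net I) (speed I)
     {(T, U) \<in> covering_plans (net I) (trucks I) (drones I) (customers (net I)).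
        damaged I \<subseteq> visited (net I) T}"

text \<open>
  A rule fixing one optimal family \<open>S N \<alpha> m n W\<close> among the possibly many ones. Since \<open>S\<close> has no
  access to the set of damaged nodes, the first-stage tours do not depend on that set.
\<close>

type_synonym 'v rule = "'v network \<Rightarrow> real \<Rightarrow> nat \<Rightarrow> nat \<Rightarrow> 'v set \<Rightarrow> 'v plan"

definition selection_rule :: "'v rule \<Rightarrow> bool" where
  "selection_rule S \<longleftrightarrow>
     (\<forall>N \<alpha> m n W. relief_network N \<longrightarrow> \<alpha> > 0 \<longrightarrow> m + n \<ge> 1 \<longrightarrow> W \<subseteq> customers N \<longrightarrow>
        optimal_plan N \<alpha> m n W (S N \<alpha> m n W))"

lemma selection_rule_exists: "\<exists>S. selection_rule S"
  unfolding selection_rule_def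
  by (rule exI[of _ "\<lambda>N \<alpha> m n W. SOME F. optimal_plan N \<alpha> m n W F"])
    (blast intro: someI_ex optimal_plan_exists)

definition missed_damaged :: "'v rule \<Rightarrow> 'v rdp_instance \<Rightarrow> 'v set" where
  "missed_damaged S I =
     damaged I - visited (net I)
       (fst (S (net I) (speed I) (trucks I) (drones I) (customers (net I))))"

definition Optimistic :: "'v rule \<Rightarrow> 'v rdp_instance \<Rightarrow> real" where
  "Optimistic S I =
     TSP (net I) (speed I) (trucks I) (drones I) (customers (net I)) +
     TSP (net I) (speed I) (trucks I) 0 (missed_damaged S I)"

definition competitive_ratio :: "('v rdp_instance \<Rightarrow> real) \<Rightarrow> nat \<Rightarrow> nat \<Rightarrow> real \<Rightarrow> ereal" where
  "competitive_ratio A kt kd \<alpha> =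
     (SUP I \<in> {I. valid_instance I \<and> trucks I = kt \<and> drones I = kd \<and> speed I = \<alpha>}.
        ereal (A I / OPT I))"

end

theory Submission
  imports Defs
begin

text \<open>
  An optimal full-information family covers all customers, and its truck tours cover all damaged
  nodes; so each of the two stages takes at most the full-information optimum. For the other bound,
  every missed damaged node lies on a first-stage drone tour. Split the drone tours into
  \<open>k\<^sup>t\<close> blocks of at most \<open>\<lceil>k\<^sup>d/k\<^sup>t\<rceil>\<close> tours and let each truck traverse one block: since a drone tour
  has length at most \<open>\<alpha>\<close> times the first-stage makespan, this bounds the second stage.
\<close>

section \<open>Concatenating tours\<close>

lemma is_tour_Nil:
  assumes "relief_network N"
  shows "is_tour N []"
proof -
  interpret pair_graph "graph_of N" using assms by (simp add: relief_network_def)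
  show ?thesis using assms by (simp add: is_tour_def awalk_Nil_iff relief_network_def)
qed

lemma
  assumes "relief_network N" and "is_tour N p" and "is_tour N q"
  shows is_tour_append: "is_tour N (p @ q)"
    and verts_tour_append: "set (pawalk_verts (depot N) (p @ q)) =
      set (pawalk_verts (depot N) p) \<union> set (pawalk_verts (depot N) q)"
    and tour_length_append: "tour_length N (p @ q) = tour_length N p + tour_length N q"
proof -
  interpret pair_graph "graph_of N" using assms(1) by (simp add: relief_network_def)
  have p: "awalk (depot N) p (depot N)" and q: "awalk (depot N) q (depot N)"
    using assms(2,3) by (auto simp: is_tour_def)
  show "is_tour N (p @ q)"
    using p q by (auto simp: is_tour_def intro: awalk_appendI)
  show "set (pawalk_verts (depot N) (p @ q)) =
      set (pawalk_verts (depot N) p) \<union> set (pawalk_verts (depot N) q)"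
    using set_awalk_verts_append[OF p q] by simp
  show "tour_length N (p @ q) = tour_length N p + tour_length N q"
    by (simp add: tour_length_def)
qed

text \<open>The lower bound \<open>\<delta> * real (length p)\<close> from
  \<open>tour_length_ge\<close> is itself nonnegative.\<close>

lemma tour_length_nonneg:
  assumes "relief_network N" and "is_tour N p"
  shows "tour_length N p \<ge> 0"
  using assms by (elim tour_length_ge) (metis mult_nonneg_nonneg less_imp_le of_nat_0_le_iff order_trans)

text \<open>Additivity under append gives \<open>x = x + x\<close> for the empty tour.\<close>

lemma tour_length_Nil: "relief_network N \<Longrightarrow> tour_length N [] = 0"
  using tour_length_append[of N "[]" "[]"] by (simp add: is_tour_Nil)

lemma is_tour_concat:
  "\<lbrakk>relief_network N; \<forall>p \<in> set ps. is_tour N p\<rbrakk> \<Longrightarrow> is_tour N (concat ps)"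
  by (induction ps) (auto simp: is_tour_Nil is_tour_append)

text \<open>Only an inclusion: for \<open>ps = []\<close> nothing is visited, yet the empty walk
  still contains the depot.\<close>

lemma visited_subset_verts_concat:
  "\<lbrakk>relief_network N; \<forall>p \<in> set ps. is_tour N p\<rbrakk> \<Longrightarrow>
    visited N ps \<subseteq> set (pawalk_verts (depot N) (concat ps))"
  by (induction ps) (auto simp: visited_def verts_tour_append is_tour_concat)

lemma tour_length_concat_le:
  assumes "relief_network N" and "\<forall>p \<in> set ps. is_tour N p \<and> tour_length N p \<le> B"
  shows "tour_length N (concat ps) \<le> real (length ps) * B"
  using assms(2)
  by (induction ps)
    (auto simp: tour_length_append is_tour_concat tour_length_Nil assms(1) algebra_simps)

section \<open>Makespans\<close>

lemma
  assumes "(T, U) \<in> plans N m n"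
  shows truck_tour_le_makespan: "p \<in> set T \<Longrightarrow> tour_length N p \<le> makespan N \<alpha> (T, U)"
    and drone_tour_le_makespan:
      "\<lbrakk>p \<in> set U; \<alpha> > 0\<rbrakk> \<Longrightarrow> tour_length N p \<le> \<alpha> * makespan N \<alpha> (T, U)"
proof -
  show "tour_length N p \<le> makespan N \<alpha> (T, U)" if "p \<in> set T"
    unfolding makespan_def using that by (auto intro: Max_ge)
  show "tour_length N p \<le> \<alpha> * makespan N \<alpha> (T, U)" if "p \<in> set U" and "\<alpha> > 0"
  proof -
    have "1 / \<alpha> * tour_length N p \<le> makespan N \<alpha> (T, U)"
      unfolding makespan_def prod.case using that(1) by (intro Max_ge) auto
    then show ?thesis using that(2) by (simp add: field_simps)
  qed
qed

text \<open>With a truck present, the maximum dominates the length of some truck tour, which is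
  nonnegative.\<close>

lemma makespan_nonneg:
  assumes "relief_network N" and "(T, U) \<in> plans N m n" and "m \<ge> 1"
  shows "makespan N \<alpha> (T, U) \<ge> 0"
proof -
  from assms(2,3) obtain p where p: "p \<in> set T" "is_tour N p"
    by (cases T) (auto simp: plans_def)
  then show ?thesis
    using tour_length_nonneg[OF assms(1)] truck_tour_le_makespan[OF assms(2)] order_trans by blast
qed

text \<open>At least one truck is required so that \<open>Max\<close> ranges over a nonempty
  set.\<close>

lemma makespan_trucks_le:
  assumes "length T \<ge> 1" and "\<forall>p \<in> set T. tour_length N p \<le> B"
  shows "makespan N \<alpha> (T, []) \<le> B"
  using assms unfolding makespan_def by (cases T) (auto simp: Max_le_iff simp del: Max_insert)

text \<open>\<open>LEAST\<close> over the reals is informative only when the minimum is attained;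
  \<open>F\<close> supplies the nonemptiness that \<open>optimum_attained\<close> asks for.\<close>

lemma TSP_le_makespan:
  assumes "relief_network N" and "\<alpha> > 0" and "F \<in> covering_plans N m n W"
  shows "TSP N \<alpha> m n W \<le> makespan N \<alpha> F"
proof -
  have "covering_plans N m n W \<subseteq> plans N m n" by (auto simp: covering_plans_def)
  then obtain F' where "optimal_plan N \<alpha> m n W F'"
    using optimum_attained[OF assms(1,2)] assms(3) unfolding optimal_plan_def by blast
  then show ?thesis using assms(3) TSP_eq_makespan unfolding optimal_plan_def by metis
qed

text \<open>Both bounds on the second stage come from here: each exhibits suitable truck tours
  \<open>T\<close>.\<close>

lemma TSP_trucks_le:
  assumes "relief_network N" and "\<alpha> > 0" and "length T \<ge> 1"
    and "\<forall>p \<in> set T. is_tour N p \<and> tour_length N p \<le> B" and "W \<subseteq> visited N T"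
  shows "TSP N \<alpha> (length T) 0 W \<le> B"
proof -
  have "(T, []) \<in> covering_plans N (length T) 0 W"
    using assms(4,5) by (auto simp: covering_plans_def plans_def)
  then have "TSP N \<alpha> (length T) 0 W \<le> makespan N \<alpha> (T, [])"
    by (rule TSP_le_makespan[OF assms(1,2)])
  also have "\<dots> \<le> B" using assms(3,4) by (intro makespan_trucks_le) auto
  finally show ?thesis .
qed

section \<open>The two bounds\<close>

lemma OPT_attained:
  assumes "valid_instance I"
  obtains T U where "(T, U) \<in> covering_plans (net I) (trucks I) (drones I) (customers (net I))"
    and "damaged I \<subseteq> visited (net I) T" and "OPT I = makespan (net I) (speed I) (T, U)"
proof -
  let ?N = "net I"
  let ?P = "{(T, U) \<in> covering_plans ?N (trucks I) (drones I) (customers ?N).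
        damaged I \<subseteq> visited ?N T}"
  have I: "relief_network ?N" "speed I > 0" "trucks I \<ge> 1" "damaged I \<subseteq> customers ?N"
    using assms by (auto simp: valid_instance_def)
  obtain p where p: "is_tour ?N p" "customers ?N \<subseteq> set (pawalk_verts (depot ?N) p)"
    using covering_tour[OF I(1) order_refl] by blast
  \<comment> \<open>Feasibility: every vehicle follows one tour through all customers, so the trucks
    reach all damaged nodes.\<close>
  have "(replicate (trucks I) p, replicate (drones I) p) \<in> ?P"
    using p I(3,4) by (auto simp: covering_plans_def plans_def visited_def)
  then have "?P \<noteq> {}" by blast
  moreover have "?P \<subseteq> plans ?N (trucks I) (drones I)" by (auto simp: covering_plans_def)
  ultimately obtain F where F: "F \<in> ?P"
      "\<forall>F' \<in> ?P. makespan ?N (speed I) F \<le> makespan ?N (speed I) F'"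
    using optimum_attained[OF I(1,2)] by meson
  have "OPT I = makespan ?N (speed I) F"
    unfolding OPT_def by (rule min_makespan_eq[OF F])
  with F(1) show ?thesis using that by (cases F) auto
qed

lemma ceiling_quotient_nonneg: "\<lceil>real a / real b\<rceil> \<ge> 0"
  using ceiling_mono[of 0 "real a / real b"] by simp

text \<open>All tours start and end at the depot, so the \<open>r\<close> consecutive tours of a
  block concatenate to a single tour. Truck \<open>i\<close> receives the tours with indices from
  \<open>i * r\<close> up to \<open>i * r + r - 1\<close>, as far as they exist.\<close>

lemma split_drone_tours:
  assumes "relief_network N" and "\<forall>p \<in> set U. is_tour N p \<and> tour_length N p \<le> B"
    and "B \<ge> 0" and "length U \<le> m * r"
  obtains T where "length T = m"
    and "\<forall>p \<in> set T. is_tour N p \<and> tour_length N p \<le> real r * B"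
    and "visited N U \<subseteq> visited N T"
proof
  define block where "block i = take r (drop (i * r) U)" for i
  let ?T = "map (\<lambda>i. concat (block i)) [0..<m]"
  have block: "set (block i) \<subseteq> set U" for i
    unfolding block_def by (meson set_drop_subset set_take_subset subset_trans)
  then have tours: "\<forall>p \<in> set (block i). is_tour N p \<and> tour_length N p \<le> B" for i
    using assms(2) by blast
  show "length ?T = m" by simp
  have "tour_length N (concat (block i)) \<le> real r * B" for i
  proof -
    have "tour_length N (concat (block i)) \<le> real (length (block i)) * B"
      by (rule tour_length_concat_le[OF assms(1) tours])
    \<comment> \<open>Late blocks may be shorter than \<open>r\<close> or empty, whence the
      assumption \<open>B \<ge> 0\<close>.\<close>
    also have "\<dots> \<le> real r * B"
      using assms(3) by (intro mult_right_mono) (auto simp: block_def)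
    finally show ?thesis .
  qed
  with tours show "\<forall>p \<in> set ?T. is_tour N p \<and> tour_length N p \<le> real r * B"
    by (auto intro: is_tour_concat[OF assms(1)])
  show "visited N U \<subseteq> visited N ?T"
  proof
    fix v assume "v \<in> visited N U"
    then obtain j where j: "j < length U" "v \<in> set (pawalk_verts (depot N) (U ! j))"
      unfolding visited_def by (metis UN_E in_set_conv_nth)
    \<comment> \<open>Tour \<open>j\<close> sits at position \<open>j mod r\<close> of block
      \<open>j div r\<close>, and \<open>j < m * r\<close> ensures that this block exists.\<close>
    have jm: "j < m * r" using j(1) assms(4) by simp
    then have r: "r > 0" by (cases r) auto
    have i: "j div r < m" using jm by (simp add: less_mult_imp_div_less)
    have le: "j div r * r \<le> length U"
      using j(1) div_times_less_eq_dividend[of j r] by linarith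
    have "block (j div r) ! (j mod r) = U ! j" "j mod r < length (block (j div r))"
      using r j(1) le by (auto simp: block_def less_diff_conv div_mult_mod_eq add.commute)
    then have "U ! j \<in> set (block (j div r))" by (metis nth_mem)
    with j(2) have "v \<in> visited N (block (j div r))" by (auto simp: visited_def)
    then have "v \<in> set (pawalk_verts (depot N) (concat (block (j div r))))"
      using visited_subset_verts_concat[OF assms(1)] tours by blast
    with i show "v \<in> visited N ?T" by (auto simp: visited_def)
  qed
qed

text \<open>The truck tours of an optimal full-information family visit every damaged node, in
  particular the missed ones.\<close>

lemma TSP_missed_le_OPT:
  assumes "valid_instance I"
  shows "TSP (net I) (speed I) (trucks I) 0 (missed_damaged S I) \<le> OPT I"
proof -
  from OPT_attained[OF assms] obtain T U
    where F: "(T, U) \<in> covering_plans (net I) (trucks I) (drones I) (customers (net I))"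
    and D: "damaged I \<subseteq> visited (net I) T" and opt: "OPT I = makespan (net I) (speed I) (T, U)" .
  have P: "(T, U) \<in> plans (net I) (trucks I) (drones I)"
    using F by (auto simp: covering_plans_def)
  then have len: "length T = trucks I" and tours: "\<forall>p \<in> set T. is_tour (net I) p"
    by (auto simp: plans_def)
  show ?thesis
    unfolding len[symmetric] opt
    using assms D tours truck_tour_le_makespan[OF P] len
    by (intro TSP_trucks_le) (auto simp: valid_instance_def missed_damaged_def)
qed

text \<open>The first stage covers all customers, so nodes missed by its trucks lie on its drone
  tours, which the trucks can repeat in blocks.\<close>

lemma TSP_missed_le_TSP_customers:
  assumes "valid_instance I" and "selection_rule S"
  shows "TSP (net I) (speed I) (trucks I) 0 (missed_damaged S I) \<le>
    real_of_int \<lceil>real (drones I) / real (trucks I)\<rceil> * speed I *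
      TSP (net I) (speed I) (trucks I) (drones I) (customers (net I))"
proof -
  let ?N = "net I" and ?\<alpha> = "speed I" and ?m = "trucks I" and ?n = "drones I"
  let ?t = "TSP ?N ?\<alpha> ?m ?n (customers ?N)"
  define r where "r = nat \<lceil>real ?n / real ?m\<rceil>"
  have I: "relief_network ?N" "?\<alpha> > 0" "?m \<ge> 1" "damaged I \<subseteq> customers ?N"
    using assms(1) by (auto simp: valid_instance_def)
  obtain T U where S: "S ?N ?\<alpha> ?m ?n (customers ?N) = (T, U)" by fastforce
  have opt: "optimal_plan ?N ?\<alpha> ?m ?n (customers ?N) (T, U)"
    using assms(2) I unfolding selection_rule_def S[symmetric] by auto
  then have P: "(T, U) \<in> plans ?N ?m ?n" and cover: "customers ?N \<subseteq> visited ?N T \<union> visited ?N U"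
    by (auto simp: optimal_plan_def covering_plans_def)
  have t: "?t = makespan ?N ?\<alpha> (T, U)" by (rule TSP_eq_makespan[OF opt])
  \<comment> \<open>Since \<open>r\<close> is rounded up, \<open>?m\<close> blocks of
    \<open>r\<close> tours have room for all \<open>?n\<close> drone tours.\<close>
  have "real ?n \<le> real ?m * real r"
  proof -
    have "real ?n / real ?m \<le> real r" unfolding r_def by linarith
    then show ?thesis using I(3) by (simp add: field_simps)
  qed
  then have "length U \<le> ?m * r"
    using P by (simp add: plans_def flip: of_nat_mult)
  moreover have "\<forall>p \<in> set U. is_tour ?N p \<and> tour_length ?N p \<le> ?\<alpha> * ?t"
    unfolding t using P drone_tour_le_makespan[OF P _ I(2)] by (auto simp: plans_def)
  moreover have "?\<alpha> * ?t \<ge> 0"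
    unfolding t using makespan_nonneg[OF I(1) P I(3)] I(2) by simp
  ultimately obtain T' where T': "length T' = ?m"
      "\<forall>p \<in> set T'. is_tour ?N p \<and> tour_length ?N p \<le> real r * (?\<alpha> * ?t)"
      "visited ?N U \<subseteq> visited ?N T'"
    using split_drone_tours[OF I(1)] by metis
  have "missed_damaged S I \<subseteq> visited ?N T'"
    using I(4) cover T'(3) by (auto simp: missed_damaged_def S)
  then have "TSP ?N ?\<alpha> ?m 0 (missed_damaged S I) \<le> real r * (?\<alpha> * ?t)"
    using TSP_trucks_le[OF I(1,2) _ T'(2)] T'(1) I(3) by simp
  moreover have "real r = real_of_int \<lceil>real ?n / real ?m\<rceil>"
    unfolding r_def by (simp add: ceiling_quotient_nonneg)
  ultimately show ?thesis by (simp add: mult.assoc)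
qed

text \<open>The product form stays meaningful when \<open>OPT I\<close> is zero; the quotient is
  formed only at the end.\<close>

lemma Optimistic_le:
  assumes "valid_instance I" and "selection_rule S"
  shows "Optimistic S I \<le>
    min 2 (1 + real_of_int \<lceil>real (drones I) / real (trucks I)\<rceil> * speed I) * OPT I"
    and "OPT I \<ge> 0"
proof -
  let ?t = "TSP (net I) (speed I) (trucks I) (drones I) (customers (net I))"
  let ?u = "TSP (net I) (speed I) (trucks I) 0 (missed_damaged S I)"
  let ?c = "real_of_int \<lceil>real (drones I) / real (trucks I)\<rceil> * speed I"
  from OPT_attained[OF assms(1)] obtain T U
    where F: "(T, U) \<in> covering_plans (net I) (trucks I) (drones I) (customers (net I))"
    and opt: "OPT I = makespan (net I) (speed I) (T, U)" .
  have I: "relief_network (net I)" "speed I > 0" "trucks I \<ge> 1"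
    using assms(1) by (auto simp: valid_instance_def)
  \<comment> \<open>An optimal full-information family is also a candidate for the first stage,
    which merely drops the condition on damaged nodes.\<close>
  have t: "?t \<le> OPT I"
    unfolding opt by (rule TSP_le_makespan[OF I(1,2) F])
  show "OPT I \<ge> 0"
    unfolding opt using F makespan_nonneg[OF I(1) _ I(3)] by (auto simp: covering_plans_def)
  have "?c * ?t \<le> ?c * OPT I"
    using t I(2) by (intro mult_left_mono mult_nonneg_nonneg)
      (simp_all only: ceiling_quotient_nonneg of_int_0_le_iff less_imp_le)
  then have "?u \<le> ?c * OPT I"
    using TSP_missed_le_TSP_customers[OF assms] by linarith
  moreover have "?u \<le> OPT I" by (rule TSP_missed_le_OPT[OF assms(1)])
  ultimately show "Optimistic S I \<le> min 2 (1 + ?c) * OPT I"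
    using t by (auto simp: Optimistic_def min_def algebra_simps)
qed

theorem lemma15:
  fixes \<alpha> :: real and kt kd :: nat and S :: "'v rule"
  assumes "\<alpha> > 0" and "kt \<ge> 1" and "kd \<ge> 1"
    and "selection_rule S"
  shows "competitive_ratio (Optimistic S) kt kd \<alpha>
           \<le> ereal (min 2 (1 + real_of_int \<lceil>real kd / real kt\<rceil> * \<alpha>))"
  unfolding competitive_ratio_def
proof (rule SUP_least)
  let ?b = "min 2 (1 + real_of_int \<lceil>real kd / real kt\<rceil> * \<alpha>)"
  fix I :: "'v rdp_instance"
  assume "I \<in> {I. valid_instance I \<and> trucks I = kt \<and> drones I = kd \<and> speed I = \<alpha>}"
  then have le: "Optimistic S I \<le> ?b * OPT I" and opt: "OPT I \<ge> 0"
    using Optimistic_le[OF _ assms(4)] by auto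
  have "?b \<ge> 0" using assms(1) ceiling_quotient_nonneg[of kd kt] by simp
  \<comment> \<open>For \<open>OPT I = 0\<close> the quotient is \<open>0\<close> by the convention
    on division by zero, so \<open>?b \<ge> 0\<close> suffices.\<close>
  then have "Optimistic S I / OPT I \<le> ?b"
    using le opt by (cases "OPT I = 0") (simp, simp only: divide_le_eq, simp)
  then show "ereal (Optimistic S I / OPT I) \<le> ereal ?b" by simp
qed

end
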